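(* Let $G$ be a bi-block graph with $N=\sum_{i=1}^r(m_i+n_i)-r+1$ vertices $v_1,\dots,v_N$ and $r>1$ blocks $G_i=K_{m_i,n_i}$, $i=1,\dots,r$, let $q\neq -1$, and let $\mathscr{D}(G)$ be its $q$-distance matrix. Then $$\xi(\mathscr{D}(G))=\prod_{i=1}^r(-1)^{m_i+n_i-1}(q+1)^{m_i+n_i-1}\left[q^2(m_i-1)(n_i-1)-1\right]$$ and $$\det(\mathscr{D}(G))=\sum_{i=1}^r\det(\mathscr{D}(G_i))\prod_{j\neq i}\xi(\mathscr{D}(G_j)),$$ where $\det(\mathscr{D}(G_i))=(-1)^{m_i+n_i-2}(q+1)^{m_i+n_i-2}\left[(q+1)^2(m_i-1)(n_i-1)-m_in_i\right]$ and $\xi(\mathscr{D}(G_j))=(-1)^{m_j+n_j-1}(q+1)^{m_j+n_j-1}\left[q^2(m_j-1)(n_j-1)-1\right]$.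
   Context: $q$ is a real or complex number (the paper calls it an indeterminate). For an integer $\alpha\ge1$, $[\alpha]=1+q+\cdots+q^{\alpha-1}$, $[0]=0$. The $q$-distance matrix $\mathscr{D}(G)$ of a connected graph $G$ with vertices $v_1,\dots,v_N$ has $(i,j)$ entry $[d(v_i,v_j)]$, $d$ the shortest-path distance. A bi-block graph is a connected graph each of whose blocks (maximal connected subgraphs without a cut-vertex) is a complete bipartite graph. For the vertex ordering $v_1,\dots,v_N$, write $\mathscr{D}(G)=\begin{bmatrix}0&[\alpha_1]\ \cdots\ [\alpha_{N-1}]\\ ([\beta_1],\dots,[\beta_{N-1}])^T&\mathscr{D}_1\end{bmatrix}$ with $\alpha_j=d(v_1,v_{j+1})$, $\beta_i=d(v_{i+1},v_1)$; then $\xi(\mathscr{D}(G))=\det(\mathscr{D}_1-M)$, where $M$ is the $(N-1)\times(N-1)$ matrix with $(i,j)$ entry $[\beta_i+\alpha_j]$. The same definition applies to each block $G_i$ with any ordering of its vertices.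
   Formalization: The sign in both formulas for ξ is corrected from (-1)^{m+n-1} to (-1)^{m+n}: for a single edge K_{1,1} the definition gives ξ = -(q+1), whereas the printed formula gives q+1. All else is as printed. *)

theory Defs
  imports
    "Graph_Theory.Graph_Theory"
    "Jordan_Normal_Form.Determinant"
begin

text \<open>
  Finite simple undirected graphs are the symmetric digraphs of the locale \<open>graph\<close>:
  finite, without loops or parallel arcs, every edge given by its two opposite arcs.
\<close>

definition q_num :: "'k::comm_ring_1 \<Rightarrow> nat \<Rightarrow> 'k" where
  "q_num q a = (\<Sum>k<a. q ^ k)"

text \<open>Only meaningful if some path from \<open>u\<close> to \<open>v\<close> exists (\<open>LEAST\<close> is unspecified otherwise).\<close>

definition graph_dist :: "('a, 'b) pre_digraph \<Rightarrow> 'a \<Rightarrow> 'a \<Rightarrow> nat" where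
  "graph_dist G u v = (LEAST k. \<exists>p. pre_digraph.apath G u p v \<and> length p = k)"

text \<open>
  To be used for connected \<open>H\<close>. The library counts the empty graph as not connected, so
  the vertex of a one-vertex graph has to be excluded explicitly.
\<close>

definition cut_vertex :: "('a, 'b) pre_digraph \<Rightarrow> 'a \<Rightarrow> bool" where
  "cut_vertex H v \<longleftrightarrow> v \<in> verts H
     \<and> verts (pre_digraph.del_vert H v) \<noteq> {} \<and> \<not> connected (pre_digraph.del_vert H v)"

text \<open>
  The conjunct \<open>graph H\<close> restricts the competing subgraphs to undirected ones, as a
  subgraph in the sense of the library may contain only one of two opposite arcs.
\<close>

definition is_block :: "('a, 'b) pre_digraph \<Rightarrow> ('a, 'b) pre_digraph \<Rightarrow> bool" where
  "is_block G B \<longleftrightarrow>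
     pre_digraph.max_subgraph G (\<lambda>H. graph H \<and> connected H \<and> (\<nexists>v. cut_vertex H v)) B"

definition bi_block_graph :: "('a, 'b) pre_digraph \<Rightarrow> bool" where
  "bi_block_graph G \<longleftrightarrow> graph G \<and> connected G
     \<and> (\<forall>B. is_block G B \<longrightarrow> (\<exists>m n. 1 \<le> m \<and> 1 \<le> n \<and> complete_bipartite_digraph m n B))"

definition vertex_ordering :: "('a, 'b) pre_digraph \<Rightarrow> 'a list \<Rightarrow> bool" where
  "vertex_ordering G vs \<longleftrightarrow> distinct vs \<and> set vs = verts G"

definition q_distance_matrix ::
    "'k::comm_ring_1 \<Rightarrow> ('a, 'b) pre_digraph \<Rightarrow> 'a list \<Rightarrow> 'k mat" where
  "q_distance_matrix q G vs =
     mat (length vs) (length vs) (\<lambda>(i, j). q_num q (graph_dist G (vs ! i) (vs ! j)))"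

text \<open>
  The vertices are numbered from 0 here, so the distances \<open>\<beta>\<^sub>i\<close> and \<open>\<alpha>\<^sub>j\<close> to and from the first
  vertex belong to \<open>vs ! Suc i\<close> and \<open>vs ! Suc j\<close>. Sign convention: for a single edge the
  value is \<open>- (q + 1)\<close>.
\<close>

definition q_xi :: "'k::comm_ring_1 \<Rightarrow> ('a, 'b) pre_digraph \<Rightarrow> 'a list \<Rightarrow> 'k" where
  "q_xi q G vs =
     det (mat_delete (q_distance_matrix q G vs) 0 0
        - mat (length vs - 1) (length vs - 1)
            (\<lambda>(i, j). q_num q (graph_dist G (vs ! Suc i) (vs ! 0) + graph_dist G (vs ! 0) (vs ! Suc j))))"

end

theory Submission
  imports Defs
begin

text \<open>
  Write \<open>D\<close> for the \<open>q\<close>-distance matrix of a connected graph and \<open>X\<close> for the matrix whose determinant is \<open>\<xi>\<close>.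
  Since \<open>[a + b] = [a] + q\<^sup>a [b]\<close>, row and column operations at the base vertex \<open>v\<close> turn \<open>D\<close> into the
  matrix \<open>X\<close> bordered by the \<open>v\<close>-row and \<open>v\<close>-column of \<open>D\<close>. If \<open>v\<close> is a cut vertex, then \<open>X\<close> is
  block diagonal, whence \<open>\<xi>\<close> is multiplicative and \<open>det D = det D\<^sub>1 \<xi>\<^sub>2 + \<xi>\<^sub>1 det D\<^sub>2\<close>. The same operations
  give \<open>\<xi> = det (D + J) + (q - 2) det D\<close> with the all-ones matrix \<open>J\<close>, so \<open>\<xi>\<close> does not depend on the
  base vertex and the splitting can be iterated at different cut vertices until only blocks remain. For
  \<open>K\<^sub>m\<^sub>,\<^sub>n\<close> both \<open>D\<close> and \<open>D + J\<close> are rank-two perturbations of \<open>- (q + 1)\<close> times the identity, and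
  Sylvester's determinant identity applies.
\<close>

section \<open>Determinants of matrices indexed by lists of vertices\<close>

section \<open>Determinants of kernels\<close>

text \<open>Indexing rows and columns by vertices instead of positions lets one kernel serve all
  orderings and all principal submatrices: reordering or shortening the list is enough.\<close>

definition kdet :: "('a \<Rightarrow> 'a \<Rightarrow> 'k::comm_ring_1) \<Rightarrow> 'a list \<Rightarrow> 'k" where
  "kdet f xs = det (mat (length xs) (length xs) (\<lambda>(i, j). f (xs ! i) (xs ! j)))"

lemma kdet_cong:
  assumes "xs = ys" "\<And>x y. x \<in> set ys \<Longrightarrow> y \<in> set ys \<Longrightarrow> f x y = g x y"
  shows "kdet f xs = kdet g ys"
proof -
  have "mat (length ys) (length ys) (\<lambda>(i, j). f (ys ! i) (ys ! j))
      = mat (length ys) (length ys) (\<lambda>(i, j). g (ys ! i) (ys ! j))"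
    by (rule cong_mat) (auto simp: assms(2))
  then show ?thesis by (simp add: kdet_def assms(1))
qed

lemma kdet_transpose: "kdet (\<lambda>x y. f y x) xs = kdet f xs"
proof -
  let ?A = "mat (length xs) (length xs) (\<lambda>(i, j). f (xs ! i) (xs ! j))"
  have "mat (length xs) (length xs) (\<lambda>(i, j). f (xs ! j) (xs ! i)) = transpose_mat ?A"
    by (rule eq_matI) auto
  then show ?thesis
    by (simp add: kdet_def det_transpose[of _ "length xs"])
qed

text \<open>Rows and columns undergo the same permutation, so its sign enters twice and
  cancels.\<close>

lemma kdet_reorder:
  assumes "distinct xs" "distinct ys" "set xs = set ys"
  shows "kdet f xs = kdet f ys"
proof -
  have "mset xs = mset ys"
    using assms set_eq_iff_mset_eq_distinct by blast
  then obtain p where p: "p permutes {..<length ys}" "permute_list p ys = xs"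
    by (rule mset_eq_permutation)
  let ?n = "length ys"
  let ?A = "mat ?n ?n (\<lambda>(i, j). f (ys ! i) (ys ! j))"
  let ?B = "mat ?n ?n (\<lambda>(i, j). ?A $$ (p i, j))"
  have p0: "p permutes {0..<?n}"
    using p(1) by (simp add: atLeast0LessThan)
  have lt: "p i < ?n" if "i < ?n" for i
    using permutes_in_image[OF p(1), of i] that by simp
  have len: "length xs = ?n"
    using p(2) by auto
  have xs: "xs ! i = ys ! p i" if "i < ?n" for i
    using permute_list_nth[OF p(1)] that p(2) by simp
  \<comment> \<open>\<open>det_permute_rows\<close> acts on rows only, so the columns are permuted
    as the rows of the transpose.\<close>
  have "kdet f xs = det (transpose_mat (mat ?n ?n (\<lambda>(i, j). transpose_mat ?B $$ (p i, j))))"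
    unfolding kdet_def len
    by (rule arg_cong[where f = det], rule eq_matI) (auto simp: xs lt)
  also have "\<dots> = det (mat ?n ?n (\<lambda>(i, j). transpose_mat ?B $$ (p i, j)))"
    by (rule det_transpose[of _ ?n]) simp
  also have "\<dots> = signof p * det (transpose_mat ?B)"
    by (rule det_permute_rows[OF _ p0]) simp
  also have "det (transpose_mat ?B) = det ?B"
    by (rule det_transpose[of _ ?n]) simp
  also have "det ?B = signof p * det ?A"
    by (rule det_permute_rows[OF _ p0]) simp
  also have "signof p * (signof p * det ?A) = det ?A"
    by (cases p rule: sign_cases) auto
  finally show ?thesis by (simp add: kdet_def)
qed

text \<open>The upper right block vanishes, so the matrix is block lower triangular.\<close>

lemma kdet_append:
  fixes f :: "'a \<Rightarrow> 'a \<Rightarrow> 'k::idom"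
  assumes "\<And>x y. x \<in> set xs \<Longrightarrow> y \<in> set ys \<Longrightarrow> f x y = 0"
  shows "kdet f (xs @ ys) = kdet f xs * kdet f ys"
proof -
  let ?M = "\<lambda>us vs. mat (length us) (length vs) (\<lambda>(i, j). f (us ! i) (vs ! j))"
  have "?M (xs @ ys) (xs @ ys) = four_block_mat (?M xs xs) (?M xs ys) (?M ys xs) (?M ys ys)"
    by (rule eq_matI) (auto simp: nth_append)
  moreover have "?M xs ys = 0\<^sub>m (length xs) (length ys)"
    by (rule eq_matI) (auto simp: assms)
  ultimately show ?thesis
    by (simp add: kdet_def det_four_block_mat_upper_right_zero[of _ "length xs" _ "length ys"])
qed

section \<open>Row and column operations at the first vertex of a list\<close>

lemma det_subtract_first_row:
  fixes F :: "nat \<Rightarrow> nat \<Rightarrow> 'k::comm_ring_1"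
  shows "det (mat (Suc n) (Suc n) (\<lambda>(i, j). if i = 0 then F 0 j else F i j - c i * F 0 j))
    = det (mat (Suc n) (Suc n) (\<lambda>(i, j). F i j))"
proof -
  let ?n = "Suc n"
  let ?F = "mat ?n ?n (\<lambda>(i, j). F i j)"
  \<comment> \<open>The operation is left multiplication by a lower unitriangular matrix, whose
    determinant is 1.\<close>
  let ?L = "mat ?n ?n (\<lambda>(i, j). if i = j then 1 else if j = 0 then - c i else 0)"
  have "mat ?n ?n (\<lambda>(i, j). if i = 0 then F 0 j else F i j - c i * F 0 j) = ?L * ?F" (is "?R = _")
  proof (rule eq_matI)
    fix i j assume "i < dim_row (?L * ?F)" "j < dim_col (?L * ?F)"
    then have ij: "i < ?n" "j < ?n" by auto
    have "(?L * ?F) $$ (i, j)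
        = (\<Sum>k = 0..<?n. (if i = k then 1 else if k = 0 then - c i else 0) * F k j)"
      using ij by (simp add: scalar_prod_def del: sum.op_ivl_Suc)
    \<comment> \<open>Row \<open>i\<close> of \<open>?L\<close> is supported on the columns
      \<open>i\<close> and 0. For \<open>i = 0\<close> these coincide, and the inner test keeps that
      entry from being counted twice.\<close>
    also have "\<dots> = (\<Sum>k = 0..<?n. (if k = i then F k j else 0)
        + (if k = 0 then (if i = 0 then 0 else - c i * F k j) else 0))"
      by (rule sum.cong) auto
    also have "\<dots> = F i j + (if i = 0 then 0 else - c i * F 0 j)"
      using ij by (simp add: sum.distrib sum.delta del: sum.op_ivl_Suc)
    finally show "?R $$ (i, j) = (?L * ?F) $$ (i, j)"
      using ij by simp
  qed auto
  moreover have "det ?L = prod_list (diag_mat ?L)"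
    by (rule det_lower_triangular[of ?n]) auto
  moreover have "diag_mat ?L = map (\<lambda>_. 1) [0..<?n]"
    unfolding diag_mat_def by (rule map_cong) auto
  moreover have "prod_list (map (\<lambda>_. 1 :: 'k) ks) = 1" for ks :: "nat list"
    by (induction ks) auto
  moreover have "det (?L * ?F) = det ?L * det ?F"
    by (rule det_mult[of _ ?n]) auto
  ultimately show ?thesis
    by (simp only: mult_1_left)
qed

text \<open>As \<open>v\<close> occurs only at the head of the list, the test \<open>x = v\<close>
  singles out the first row. The multiplier may depend on the vertex of the row, as the powers of
  \<open>q\<close> will.\<close>

lemma kdet_subtract_row:
  assumes "v \<notin> set xs"
  shows "kdet (\<lambda>x y. if x = v then f v y else f x y - c x * f v y) (v # xs) = kdet f (v # xs)"
proof -
  have ne: "xs ! k \<noteq> v" if "k < length xs" for k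
    using assms that by (metis nth_mem)
  have "(v # xs) ! i = v \<longleftrightarrow> i = 0" if "i < Suc (length xs)" for i
    using that ne by (cases i) auto
  then have row: "\<And>i. i < Suc (length xs) \<Longrightarrow> (v # xs) ! i = v \<longleftrightarrow> i = 0" .
  have "kdet (\<lambda>x y. if x = v then f v y else f x y - c x * f v y) (v # xs)
    = det (mat (Suc (length xs)) (Suc (length xs)) (\<lambda>(i, j).
        if i = 0 then f ((v # xs) ! 0) ((v # xs) ! j)
        else f ((v # xs) ! i) ((v # xs) ! j) - c ((v # xs) ! i) * f ((v # xs) ! 0) ((v # xs) ! j)))"
    unfolding kdet_def by (intro arg_cong[where f = det] cong_mat) (auto simp: row)
  also have "\<dots> = kdet f (v # xs)"
    using det_subtract_first_row[of "length xs" "\<lambda>i j. f ((v # xs) ! i) ((v # xs) ! j)"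
        "\<lambda>i. c ((v # xs) ! i)"]
    by (simp only: kdet_def length_Cons)
  finally show ?thesis .
qed

lemma kdet_subtract_col:
  assumes "v \<notin> set xs"
  shows "kdet (\<lambda>x y. if y = v then f x v else f x y - c y * f x v) (v # xs) = kdet f (v # xs)"
proof -
  let ?g = "\<lambda>x y. if x = v then f y v else f y x - c x * f y v"
  have "kdet (\<lambda>x y. ?g y x) (v # xs) = kdet ?g (v # xs)"
    by (rule kdet_transpose)
  also have "\<dots> = kdet (\<lambda>x y. f y x) (v # xs)"
    by (rule kdet_subtract_row[OF assms])
  also have "\<dots> = kdet f (v # xs)"
    by (rule kdet_transpose)
  finally show ?thesis .
qed

text \<open>Laplace expansion along the first row: its cofactors do not involve the entries of that
  row.\<close>

lemma kdet_row_linear: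
  assumes "v \<notin> set xs"
  shows "kdet (\<lambda>x y. if x = v then g y + c * h y else f x y) (v # xs)
    = kdet (\<lambda>x y. if x = v then g y else f x y) (v # xs)
      + c * kdet (\<lambda>x y. if x = v then h y else f x y) (v # xs)"
proof -
  let ?ws = "v # xs" and ?n = "Suc (length xs)"
  let ?A = "\<lambda>r. mat ?n ?n (\<lambda>(i, j). if ?ws ! i = v then r (?ws ! j) else f (?ws ! i) (?ws ! j))"
  have cof: "cofactor (?A r) 0 j = cofactor (?A s) 0 j" if "j < ?n" for r s j
  proof -
    have "mat_delete (?A r) 0 j = mat_delete (?A s) 0 j"
      using assms that by (intro eq_matI) (auto simp: mat_delete_def)
    then show ?thesis by (simp add: cofactor_def)
  qed
  have "det (?A r) = (\<Sum>j<?n. r (?ws ! j) * cofactor (?A g) 0 j)" for r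
    by (subst laplace_expansion_row[of _ ?n 0]) (auto intro!: sum.cong simp: cof[of _ r g])
  then have "kdet (\<lambda>x y. if x = v then r y else f x y) ?ws = (\<Sum>j<?n. r (?ws ! j) * cofactor (?A g) 0 j)"
    for r by (simp only: kdet_def length_Cons)
  then show ?thesis
    by (simp only: sum.distrib distrib_right sum_distrib_left mult.assoc)
qed

lemma kdet_col_linear:
  assumes "v \<notin> set xs"
  shows "kdet (\<lambda>x y. if y = v then g x + c * h x else f x y) (v # xs)
    = kdet (\<lambda>x y. if y = v then g x else f x y) (v # xs)
      + c * kdet (\<lambda>x y. if y = v then h x else f x y) (v # xs)"
  using kdet_row_linear[OF assms, of g c h "\<lambda>x y. f y x"]
    kdet_transpose[of "\<lambda>x y. if x = v then g y + c * h y else f y x" "v # xs"]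
    kdet_transpose[of "\<lambda>x y. if x = v then g y else f y x" "v # xs"]
    kdet_transpose[of "\<lambda>x y. if x = v then h y else f y x" "v # xs"]
  by simp

lemma kdet_single [simp]: "kdet f [v] = f v v"
  by (simp add: kdet_def det_single[of _])

section \<open>The matrix behind \<open>q_xi\<close> and its relation to the
  \<open>q\<close>-distance matrix\<close>

section \<open>Kernels built from distances\<close>

lemma q_num_0 [simp]: "q_num q 0 = 0"
  by (simp add: q_num_def)

lemma q_num_add: "q_num q (a + b) = q_num q a + q ^ a * q_num q b"
proof (induction b)
  case (Suc b)
  then show ?case by (simp add: q_num_def power_add algebra_simps)
qed (simp add: q_num_def)

text \<open>The geometric sum without division. It makes the column of multipliers
  \<open>q ^ d x v\<close> an affine function of the column of \<open>q\<close>-distances to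
  \<open>v\<close>.\<close>

lemma power_eq_q_num: "q ^ a = 1 + (q - 1) * q_num q a"
proof (induction a)
  case (Suc a)
  have "q ^ Suc a = q ^ a + (q - 1) * q ^ a"
    by (simp add: algebra_simps)
  also have "\<dots> = 1 + (q - 1) * q_num q a + (q - 1) * q ^ a"
    by (simp only: Suc)
  also have "\<dots> = 1 + (q - 1) * q_num q (Suc a)"
    by (simp add: q_num_def distrib_left)
  finally show ?case .
qed (simp add: q_num_def)

text \<open>The entry of the matrix in \<open>q_xi\<close> with base vertex \<open>v\<close>. It
  vanishes when the distance from \<open>x\<close> to \<open>y\<close> is the sum of the distances
  via \<open>v\<close>; this is what decouples the two sides of a cut vertex.\<close>

definition xi_kernel :: "'k::comm_ring_1 \<Rightarrow> ('a \<Rightarrow> 'a \<Rightarrow> nat) \<Rightarrow> 'a \<Rightarrow> 'a \<Rightarrow> 'a \<Rightarrow> 'k" where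
  "xi_kernel q d v x y = q_num q (d x y) - q_num q (d x v + d v y)"

text \<open>Subtracting column \<open>v\<close> from the others removes \<open>w\<close> everywhere
  except in column \<open>v\<close>, where linearity separates it.\<close>

lemma kdet_add_rank_one:
  assumes "v \<notin> set xs"
  shows "kdet (\<lambda>x y. f x y + w x) (v # xs)
    = kdet f (v # xs) + kdet (\<lambda>x y. if y = v then w x else f x y - f x v) (v # xs)"
proof -
  have "kdet (\<lambda>x y. f x y + w x) (v # xs)
    = kdet (\<lambda>x y. if y = v then f x v + w x else f x y + w x - 1 * (f x v + w x)) (v # xs)"
    by (rule kdet_subtract_col[OF assms, symmetric])
  also have "\<dots> = kdet (\<lambda>x y. if y = v then f x v + 1 * w x else f x y - f x v) (v # xs)"
    by (rule kdet_cong) auto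
  also have "\<dots> = kdet (\<lambda>x y. if y = v then f x v else f x y - f x v) (v # xs)
      + 1 * kdet (\<lambda>x y. if y = v then w x else f x y - f x v) (v # xs)"
    by (rule kdet_col_linear[OF assms])
  also have "kdet (\<lambda>x y. if y = v then f x v else f x y - f x v) (v # xs) = kdet f (v # xs)"
    using kdet_subtract_col[OF assms, of f "\<lambda>_. 1"] by (simp only: mult_1_left)
  finally show ?thesis by simp
qed

text \<open>The right side depends on the vertices of \<open>v # xs\<close> only as a set, by
  \<open>kdet_reorder\<close>; hence the left side does not depend on which vertex is the
  base.\<close>

lemma kdet_xi_kernel:
  fixes q :: "'k::idom"
  assumes "v \<notin> set xs" "distinct xs" "d v v = 0"
  shows "kdet (xi_kernel q d v) xs
    = kdet (\<lambda>x y. q_num q (d x y) + 1) (v # xs) + (q - 2) * kdet (\<lambda>x y. q_num q (d x y)) (v # xs)"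
proof -
  let ?D = "\<lambda>x y. q_num q (d x y)"
  \<comment> \<open>\<open>?L w\<close> is the determinant of the distance matrix after subtracting
    column \<open>v\<close> from the others and replacing column \<open>v\<close> by
    \<open>w\<close>; it is linear in \<open>w\<close>. It is evaluated at \<open>w = ?u\<close>
    directly and again through the affine form of \<open>?u\<close>.\<close>
  let ?f = "\<lambda>w x y. if y = v then w x else ?D x y - ?D x v"
  let ?L = "\<lambda>w. kdet (?f w) (v # xs)"
  let ?u = "\<lambda>x. q ^ d x v"
  let ?g = "\<lambda>x y. if x = v then ?f ?u v y else ?f ?u x y - ?u x * ?f ?u v y"
  have "?L ?u = kdet ?g (v # xs)"
    by (rule kdet_subtract_row[OF assms(1), symmetric])
  \<comment> \<open>Since \<open>?u v = 1\<close>, the row operation clears column \<open>v\<close>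
    outside row \<open>v\<close>. With \<open>v\<close> last, these zeros form the upper right
    block.\<close>
  also have "\<dots> = kdet ?g (xs @ [v])"
    using assms by (intro kdet_reorder) auto
  also have "\<dots> = kdet ?g xs * kdet ?g [v]"
    using assms by (intro kdet_append) auto
  also have "kdet ?g xs = kdet (xi_kernel q d v) xs"
    using assms by (intro kdet_cong) (auto simp: xi_kernel_def q_num_add)
  also have "kdet ?g [v] = 1"
    using assms by simp
  finally have "kdet (xi_kernel q d v) xs = ?L ?u" by simp
  also have "?u = (\<lambda>x. 1 + (q - 1) * ?D x v)"
    by (simp add: power_eq_q_num[of q])
  also have "?L (\<lambda>x. 1 + (q - 1) * ?D x v) = ?L (\<lambda>_. 1) + (q - 1) * ?L (\<lambda>x. ?D x v)"
    by (rule kdet_col_linear[OF assms(1)])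
  also have "?L (\<lambda>x. ?D x v) = kdet ?D (v # xs)"
    using kdet_subtract_col[OF assms(1), of ?D "\<lambda>_. 1"] by (simp only: mult_1_left)
  also have "?L (\<lambda>_. 1) = kdet (\<lambda>x y. ?D x y + 1) (v # xs) - kdet ?D (v # xs)"
    using kdet_add_rank_one[OF assms(1), of ?D "\<lambda>_. 1"] by simp
  finally show ?thesis by (simp add: algebra_simps)
qed

lemma kdet_q_num_bordered:
  assumes "v \<notin> set xs" "d v v = 0"
  shows "kdet (\<lambda>x y. q_num q (d x y)) (v # xs)
    = kdet (\<lambda>x y. if x = v then q_num q (d v y) else if y = v then q_num q (d x v)
        else xi_kernel q d v x y) (v # xs)" (is "kdet ?D _ = kdet ?B _")
proof -
  \<comment> \<open>Row \<open>v\<close> is subtracted with multiplier \<open>q ^ d x v\<close>,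
    then column \<open>v\<close> with multiplier 1. The border survives because
    \<open>d v v = 0\<close>; inside, \<open>q_num_add\<close> combines the subtracted terms into
    \<open>q_num q (d x v + d v y)\<close>.\<close>
  let ?g = "\<lambda>x y. if x = v then ?D v y else ?D x y - q ^ d x v * ?D v y"
  have "kdet ?D (v # xs) = kdet ?g (v # xs)"
    by (rule kdet_subtract_row[OF assms(1), symmetric])
  also have "\<dots> = kdet (\<lambda>x y. if y = v then ?g x v else ?g x y - 1 * ?g x v) (v # xs)"
    by (rule kdet_subtract_col[OF assms(1), symmetric])
  also have "\<dots> = kdet ?B (v # xs)"
    using assms by (intro kdet_cong) (auto simp: xi_kernel_def q_num_add)
  finally show ?thesis .
qed

lemma kdet_q_num_glue:
  fixes q :: "'k::idom"
  assumes dist: "distinct (v # xs @ ys)" and vv: "d v v = 0"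
    and xy: "\<And>x y. x \<in> set xs \<Longrightarrow> y \<in> set ys \<Longrightarrow> d x y = d x v + d v y"
    and yx: "\<And>x y. x \<in> set xs \<Longrightarrow> y \<in> set ys \<Longrightarrow> d y x = d y v + d v x"
  shows "kdet (\<lambda>x y. q_num q (d x y)) (v # xs @ ys)
    = kdet (\<lambda>x y. q_num q (d x y)) (v # xs) * kdet (xi_kernel q d v) ys
      + kdet (\<lambda>x y. q_num q (d x y)) (v # ys) * kdet (xi_kernel q d v) xs" (is "kdet ?D _ = _")
proof -
  let ?X = "xi_kernel q d v"
  let ?B = "\<lambda>x y. if x = v then ?D v y else if y = v then ?D x v else ?X x y"
  \<comment> \<open>Row \<open>v\<close> of the bordered matrix is the sum of its restrictions to
    \<open>xs\<close> and to \<open>ys\<close>, the corner being 0. Each restriction leaves a block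
    triangular matrix, with \<open>v\<close> attached to one side.\<close>
  let ?r = "\<lambda>zs y. if y \<in> set zs then ?D v y else 0"
  let ?C = "\<lambda>zs x y. if x = v then ?r zs y else ?B x y"
  have part: "kdet (?C us) (v # us @ ws) = kdet ?D (v # us) * kdet ?X ws"
    if "distinct (v # us @ ws)" "\<And>x y. x \<in> set us \<Longrightarrow> y \<in> set ws \<Longrightarrow> ?X x y = 0" for us ws
  proof -
    have "kdet (?C us) ((v # us) @ ws) = kdet (?C us) (v # us) * kdet (?C us) ws"
      using that by (intro kdet_append) auto
    also have "kdet (?C us) (v # us) = kdet ?B (v # us)"
      using that vv by (intro kdet_cong) auto
    also have "\<dots> = kdet ?D (v # us)"
      using that vv by (intro kdet_q_num_bordered[symmetric]) auto
    also have "kdet (?C us) ws = kdet ?X ws"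
      using that by (intro kdet_cong) auto
    finally show ?thesis by simp
  qed
  have "kdet ?D (v # xs @ ys) = kdet ?B (v # xs @ ys)"
    using dist vv by (intro kdet_q_num_bordered) auto
  also have "\<dots> = kdet (\<lambda>x y. if x = v then ?r xs y + 1 * ?r ys y else ?B x y) (v # xs @ ys)"
    using dist vv by (intro kdet_cong) auto
  also have "\<dots> = kdet (?C xs) (v # xs @ ys) + 1 * kdet (?C ys) (v # xs @ ys)"
    using dist by (intro kdet_row_linear) auto
  also have "kdet (?C ys) (v # xs @ ys) = kdet (?C ys) (v # ys @ xs)"
    using dist by (intro kdet_reorder) auto
  also have "\<dots> = kdet ?D (v # ys) * kdet ?X xs"
    using dist yx by (intro part) (auto simp: xi_kernel_def)
  also have "kdet (?C xs) (v # xs @ ys) = kdet ?D (v # xs) * kdet ?X ys"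
    using dist xy by (intro part) (auto simp: xi_kernel_def)
  finally show ?thesis by simp
qed

section \<open>Determinants of rank-two perturbations of a scalar matrix\<close>

lemma det_sylvester:
  fixes A B :: "'k::idom mat"
  assumes A: "A \<in> carrier_mat n p" and B: "B \<in> carrier_mat p n"
  shows "k ^ p * det (k \<cdot>\<^sub>m 1\<^sub>m n + A * B) = k ^ n * det (k \<cdot>\<^sub>m 1\<^sub>m p + B * A)"
proof -
  \<comment> \<open>\<open>det ?P\<close> is found twice: \<open>?L\<close> clears the block
    \<open>A\<close>, and \<open>?M\<close> clears the block \<open>- B\<close>. The factor
    \<open>k\<close> in \<open>?M\<close> replaces a division by \<open>k\<close> and is the source
    of \<open>k ^ p\<close>.\<close>
  let ?P = "four_block_mat (k \<cdot>\<^sub>m 1\<^sub>m n) A (- B) (1\<^sub>m p)"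
  let ?L = "four_block_mat (1\<^sub>m n) (- A) (0\<^sub>m p n) (1\<^sub>m p)"
  let ?M = "four_block_mat (1\<^sub>m n) (0\<^sub>m n p) B (k \<cdot>\<^sub>m 1\<^sub>m p)"
  have P: "?P \<in> carrier_mat (n + p) (n + p)" using A B by auto
  have "?L * ?P = four_block_mat (1\<^sub>m n * (k \<cdot>\<^sub>m 1\<^sub>m n) + - A * - B) (1\<^sub>m n * A + - A * 1\<^sub>m p)
      (0\<^sub>m p n * (k \<cdot>\<^sub>m 1\<^sub>m n) + 1\<^sub>m p * - B) (0\<^sub>m p n * A + 1\<^sub>m p * 1\<^sub>m p)"
    using A B by (intro mult_four_block_mat) auto
  also have "1\<^sub>m n * (k \<cdot>\<^sub>m 1\<^sub>m n) + - A * - B = k \<cdot>\<^sub>m 1\<^sub>m n + A * B"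
    using A B by auto
  also have "1\<^sub>m n * A + - A * 1\<^sub>m p = 0\<^sub>m n p"
    using A by auto
  also have "0\<^sub>m p n * (k \<cdot>\<^sub>m 1\<^sub>m n) + 1\<^sub>m p * - B = - B"
    using B by auto
  also have "0\<^sub>m p n * A + 1\<^sub>m p * 1\<^sub>m p = 1\<^sub>m p"
    using A by auto
  finally have LP: "?L * ?P = four_block_mat (k \<cdot>\<^sub>m 1\<^sub>m n + A * B) (0\<^sub>m n p) (- B) (1\<^sub>m p)" .
  have "det (?L * ?P) = det ?L * det ?P"
    using A P by (intro det_mult) auto
  also have "det ?L = 1"
    using A by (subst det_four_block_mat_lower_left_zero[of _ n _ p]) auto
  finally have "det ?P = det (k \<cdot>\<^sub>m 1\<^sub>m n + A * B)"
    unfolding LP using A B by (subst (asm) det_four_block_mat_upper_right_zero[of _ n _ p]) auto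
  moreover have "?M * ?P = four_block_mat (1\<^sub>m n * (k \<cdot>\<^sub>m 1\<^sub>m n) + 0\<^sub>m n p * - B) (1\<^sub>m n * A + 0\<^sub>m n p * 1\<^sub>m p)
      (B * (k \<cdot>\<^sub>m 1\<^sub>m n) + (k \<cdot>\<^sub>m 1\<^sub>m p) * - B) (B * A + (k \<cdot>\<^sub>m 1\<^sub>m p) * 1\<^sub>m p)"
    using A B by (intro mult_four_block_mat) auto
  moreover have "1\<^sub>m n * (k \<cdot>\<^sub>m 1\<^sub>m n) + 0\<^sub>m n p * - B = k \<cdot>\<^sub>m 1\<^sub>m n"
    using B by auto
  moreover have "1\<^sub>m n * A + 0\<^sub>m n p * 1\<^sub>m p = A"
    using A by auto
  moreover have "B * (k \<cdot>\<^sub>m 1\<^sub>m n) + (k \<cdot>\<^sub>m 1\<^sub>m p) * - B = 0\<^sub>m p n"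
  proof -
    have "B * (k \<cdot>\<^sub>m 1\<^sub>m n) = k \<cdot>\<^sub>m B"
      using B by (metis mult_smult_distrib one_carrier_mat right_mult_one_mat)
    moreover have "(k \<cdot>\<^sub>m 1\<^sub>m p) * - B = k \<cdot>\<^sub>m (- B)"
      using B by (metis mult_smult_assoc_mat one_carrier_mat left_mult_one_mat uminus_carrier_mat)
    ultimately show ?thesis using B by auto
  qed
  moreover have "B * A + (k \<cdot>\<^sub>m 1\<^sub>m p) * 1\<^sub>m p = k \<cdot>\<^sub>m 1\<^sub>m p + B * A"
    using A B by (auto simp: comm_add_mat[of _ p p])
  ultimately have MP: "?M * ?P = four_block_mat (k \<cdot>\<^sub>m 1\<^sub>m n) A (0\<^sub>m p n) (k \<cdot>\<^sub>m 1\<^sub>m p + B * A)"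
    and P_eq: "det ?P = det (k \<cdot>\<^sub>m 1\<^sub>m n + A * B)"
    by simp_all
  have "det ?M * det ?P = det (?M * ?P)"
    using B P by (intro det_mult[symmetric]) auto
  also have "\<dots> = k ^ n * det (k \<cdot>\<^sub>m 1\<^sub>m p + B * A)"
    unfolding MP using A B by (subst det_four_block_mat_lower_left_zero[of _ n _ p]) auto
  also have "det ?M = k ^ p"
    using B by (subst det_four_block_mat_upper_right_zero[of _ n _ p]) auto
  finally show ?thesis by (simp add: P_eq)
qed

text \<open>The matrix is \<open>- s\<close> times the identity plus a matrix of rank at most two.\<close>

lemma kdet_two_classes:
  fixes s a b :: "'k::idom"
  assumes ws: "distinct ws" "set ws = U \<union> V" and UV: "U \<inter> V = {}"
    and card: "card U = m" "card V = n" and mn: "1 \<le> m" "1 \<le> n" and s: "s \<noteq> 0"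
    and f: "\<And>x y. x \<in> set ws \<Longrightarrow> y \<in> set ws \<Longrightarrow>
      f x y = (if x \<in> U \<longleftrightarrow> y \<in> U then a else b) - (if x = y then s else 0)"
  shows "kdet f ws = (- s) ^ (m + n - 2) * ((of_nat m * a - s) * (of_nat n * a - s) - of_nat m * of_nat n * b\<^sup>2)"
proof -
  let ?N = "length ws"
  \<comment> \<open>\<open>?c\<close> is the class of a position. \<open>?A\<close> assigns vertices
    to classes and \<open>?B\<close> gives the value between a class and a vertex, so
    \<open>?A * ?B\<close> holds \<open>a\<close> within and \<open>b\<close> across the
    classes.\<close>
  let ?c = "\<lambda>i. if ws ! i \<in> U then 0 else 1 :: nat"
  let ?A = "mat ?N 2 (\<lambda>(i, j). if j = ?c i then 1 else 0 :: 'k)"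
  let ?B = "mat 2 ?N (\<lambda>(i, j). if i = ?c j then a else b)"
  let ?k = "- s"
  have fin: "finite U" "finite V" using ws(2) by (metis List.finite_set finite_Un)+
  have N: "?N = m + n"
    using ws UV card fin by (metis card_Un_disjoint distinct_card)
  have U: "(\<Sum>i<?N. if ws ! i \<in> U then g else h) = of_nat m * g + of_nat n * h" for g h :: 'k
  proof -
    have "(\<Sum>i<?N. if ws ! i \<in> U then g else h) = (\<Sum>x\<in>set ws. if x \<in> U then g else h)"
      using ws(1) by (intro sum.reindex_bij_betw bij_betw_nth) auto
    also have "\<dots> = (\<Sum>x\<in>U. g) + (\<Sum>x\<in>V. h)"
    proof -
      have "(\<Sum>x\<in>V. if x \<in> U then g else h) = (\<Sum>x\<in>V. h)"
        by (rule sum.cong) (use UV in auto)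
      then show ?thesis
        unfolding ws(2) using fin UV by (simp add: sum.union_disjoint)
    qed
    finally show ?thesis by (simp add: card)
  qed
  have "mat ?N ?N (\<lambda>(i, j). f (ws ! i) (ws ! j)) = ?k \<cdot>\<^sub>m 1\<^sub>m ?N + ?A * ?B"
    using ws(1) by (intro eq_matI) (auto simp: f scalar_prod_def numeral_2_eq_2 nth_eq_iff_index_eq)
  \<comment> \<open>Sylvester's identity leaves a 2 by 2 determinant, indexed by the two
    classes.\<close>
  then have "?k ^ 2 * kdet f ws = ?k ^ ?N * det (?k \<cdot>\<^sub>m 1\<^sub>m 2 + ?B * ?A)"
    unfolding kdet_def using det_sylvester[of ?A ?N 2 ?B ?k] by simp
  also have "?k \<cdot>\<^sub>m 1\<^sub>m 2 + ?B * ?A = mat 2 2 (\<lambda>(i, j).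
      of_nat (if j = 0 then m else n) * (if i = j then a else b) - (if i = j then s else 0))" (is "_ = ?S")
  proof (rule eq_matI)
    fix i j assume "i < dim_row ?S" "j < dim_col ?S"
    then have ij: "i < 2" "j < 2" by auto
    then have "(?B * ?A) $$ (i, j) = (\<Sum>k<?N. (if i = ?c k then a else b) * (if j = ?c k then 1 else 0))"
      by (simp add: scalar_prod_def atLeast0LessThan)
    also have "\<dots> = (\<Sum>k<?N. if ws ! k \<in> U then (if j = 0 then if i = 0 then a else b else 0)
        else (if j = 1 then if i = 1 then a else b else 0))"
      by (rule sum.cong) auto
    also have "\<dots> = of_nat (if j = 0 then m else n) * (if i = j then a else b)"
      unfolding U using ij by (auto simp: less_2_cases_iff)
    finally show "(?k \<cdot>\<^sub>m 1\<^sub>m 2 + ?B * ?A) $$ (i, j) = ?S $$ (i, j)"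
      using ij by simp
  qed auto
  also have "det ?S = (of_nat m * a - s) * (of_nat n * a - s) - of_nat m * of_nat n * b\<^sup>2"
    by (subst laplace_expansion_row[of _ 2 0])
      (simp_all add: numeral_2_eq_2 cofactor_def mat_delete_def det_single algebra_simps)
  \<comment> \<open>Both classes are inhabited, so \<open>?N\<close> is at least 2, and
    \<open>?k ^ 2\<close> can be cancelled because \<open>s\<close> is nonzero.\<close>
  also have "?k ^ ?N = ?k ^ 2 * ?k ^ (m + n - 2)"
  proof -
    have "?N = 2 + (m + n - 2)" using mn N by simp
    then show ?thesis by (metis power_add)
  qed
  finally show ?thesis using s by simp
qed

section \<open>Shortest-path distances through powers of the adjacency relation\<close>

section \<open>Distances\<close>

context wf_digraph begin

lemma awalk_relpow: "awalk u p v \<Longrightarrow> (u, v) \<in> arcs_ends G ^^ length p"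
proof (induction p arbitrary: u)
  case (Cons e p)
  then have "(u, head G e) \<in> arcs_ends G" "(head G e, v) \<in> arcs_ends G ^^ length p"
    by (auto simp: awalk_Cons_iff arcs_ends_conv)
  then show ?case
    unfolding length_Cons by (rule relpow_Suc_I2)
qed (simp add: awalk_Nil_iff)

lemma relpow_awalk:
  "\<lbrakk>(u, v) \<in> arcs_ends G ^^ k; u \<in> verts G\<rbrakk> \<Longrightarrow> \<exists>p. awalk u p v \<and> length p = k"
proof (induction k arbitrary: u)
  case (Suc k)
  then obtain w where w: "(u, w) \<in> arcs_ends G" "(w, v) \<in> arcs_ends G ^^ k"
    by (meson relpow_Suc_D2)
  then obtain p where "awalk w p v" "length p = k"
    using Suc.IH adj_in_verts by blast
  moreover obtain e where "e \<in> arcs G" "tail G e = u" "head G e = w"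
    using w(1) by (rule reachableE)
  ultimately have "awalk u (e # p) v \<and> length (e # p) = Suc k"
    by (simp add: awalk_Cons_iff)
  then show ?case by blast
qed (simp add: awalk_Nil_iff)

text \<open>A path without repeated vertices repeats no arc, and its arcs all occur in the walk, so
  counting arcs suffices.\<close>

lemma length_awalk_to_apath:
  assumes "awalk u p v"
  shows "length (awalk_to_apath p) \<le> length p"
proof -
  have "distinct (awalk_to_apath p)"
    using apath_awalk_to_apath[OF assms] unfolding apath_def
    by (elim conjE) (rule distinct_verts_imp_distinct)
  then have "length (awalk_to_apath p) = card (set (awalk_to_apath p))"
    by (simp add: distinct_card)
  also have "\<dots> \<le> card (set p)"
    using awalk_to_apath_subset[OF assms] by (simp add: card_mono)
  also have "\<dots> \<le> length p"
    by (rule card_length)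
  finally show ?thesis .
qed

text \<open>Every walk shortens to a simple path, so the minimum over simple paths is also the
  minimum over walks: the distance is the least exponent of the adjacency relation that relates
  \<open>u\<close> to \<open>v\<close>.\<close>

lemma graph_dist_relpow:
  assumes "(u, v) \<in> arcs_ends G ^^ k" "u \<in> verts G"
  shows "(u, v) \<in> arcs_ends G ^^ graph_dist G u v" "graph_dist G u v \<le> k"
proof -
  let ?P = "\<lambda>k. \<exists>p. apath u p v \<and> length p = k"
  obtain p where p: "awalk u p v" "length p = k"
    using relpow_awalk[OF assms] by blast
  then have P: "?P (length (awalk_to_apath p))"
    using apath_awalk_to_apath[OF p(1)] by blast
  have "?P (graph_dist G u v)"
    unfolding graph_dist_def using P by (rule LeastI)
  then obtain p' where p': "apath u p' v" "length p' = graph_dist G u v" by blast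
  show "(u, v) \<in> arcs_ends G ^^ graph_dist G u v"
    using awalk_relpow[OF awalkI_apath[OF p'(1)]] by (simp only: p'(2))
  have "graph_dist G u v \<le> length (awalk_to_apath p)"
    unfolding graph_dist_def using P by (rule Least_le)
  then show "graph_dist G u v \<le> k"
    using length_awalk_to_apath[OF p(1)] p(2) by linarith
qed

lemma graph_dist_self: "u \<in> verts G \<Longrightarrow> graph_dist G u u = 0"
  using graph_dist_relpow(2)[of u u 0] by simp

lemma reachable_relpow:
  assumes "u \<rightarrow>\<^sup>*\<^bsub>G\<^esub> v"
  shows "(u, v) \<in> arcs_ends G ^^ graph_dist G u v"
proof -
  obtain k where "(u, v) \<in> arcs_ends G ^^ k"
    using assms by (auto simp: reachable_conv rtrancl_power)
  then show ?thesis
    using graph_dist_relpow(1) assms reachable_in_verts by blast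
qed

lemma graph_dist_triangle:
  assumes "u \<rightarrow>\<^sup>*\<^bsub>G\<^esub> v" "v \<rightarrow>\<^sup>*\<^bsub>G\<^esub> w"
  shows "graph_dist G u w \<le> graph_dist G u v + graph_dist G v w"
  using assms reachable_relpow reachable_in_verts
  by (intro graph_dist_relpow(2)) (auto simp: relpow_add)

lemma graph_dist_adj: "u \<rightarrow>\<^bsub>G\<^esub> v \<Longrightarrow> graph_dist G u v \<le> 1"
  by (intro graph_dist_relpow(2)) (auto simp: adj_in_verts)

lemma graph_dist_step:
  assumes "u \<rightarrow>\<^sup>*\<^bsub>G\<^esub> v" "v \<rightarrow>\<^bsub>G\<^esub> w"
  shows "graph_dist G u w \<le> graph_dist G u v + 1"
  using graph_dist_triangle[OF assms(1) reachable_adjI[OF assms(2)]] graph_dist_adj[OF assms(2)]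
  by linarith

text \<open>Along a shortest walk \<open>f\<close> climbs by at most one per arc. This is the source
  of lower bounds on distances, with \<open>f\<close> a guessed distance function.\<close>

lemma Lipschitz_le_graph_dist:
  assumes "u \<rightarrow>\<^sup>*\<^bsub>G\<^esub> v" "f u = (0 :: nat)" "\<And>x y. x \<rightarrow>\<^bsub>G\<^esub> y \<Longrightarrow> f y \<le> f x + 1"
  shows "f v \<le> graph_dist G u v"
proof -
  have "(u, w) \<in> arcs_ends G ^^ k \<Longrightarrow> f w \<le> k" for w k
  proof (induction k arbitrary: w)
    case (Suc k)
    then obtain x where "(u, x) \<in> arcs_ends G ^^ k" "x \<rightarrow>\<^bsub>G\<^esub> w" by auto
    then show ?case using Suc.IH assms(3) by fastforce
  qed (simp add: assms(2))
  then show ?thesis using reachable_relpow[OF assms(1)] by blast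
qed

end

context graph begin

text \<open>\<open>connected\<close> refers to the symmetric closure, which for a symmetric digraph
  adds nothing to reachability.\<close>

lemma connected_iff_reachable:
  "connected G \<longleftrightarrow> verts G \<noteq> {} \<and> (\<forall>u\<in>verts G. \<forall>v\<in>verts G. u \<rightarrow>\<^sup>*\<^bsub>G\<^esub> v)"
proof -
  have "connected G \<longleftrightarrow> strongly_connected G"
    using symmetric_connected_imp_strongly_connected[OF sym_arcs]
    by (auto simp: connected_def strongly_connected_def reachable_mk_symmetricI)
  then show ?thesis by (simp add: strongly_connected_def)
qed

lemma graph_induce_subgraph:
  assumes "S \<subseteq> verts G"
  shows "graph (G \<restriction> S)"
proof -
  have "induced_subgraph (G \<restriction> S) G"
    using assms by (rule induced_induce)
  then show ?thesis
    using digraphI_induced induced_graph_imp_symmetric[OF sym_arcs] digraph.graphI by blast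
qed

lemma del_vert_eq_induce_subgraph: "del_vert v = G \<restriction> (verts G - {v})"
  by (auto simp: del_vert_def induce_subgraph_def)

lemma graph_del_vert: "graph (del_vert v)"
  unfolding del_vert_eq_induce_subgraph by (rule graph_induce_subgraph) auto

lemma connected_singleton: "verts G = {v} \<Longrightarrow> connected G"
  by (auto simp: connected_iff_reachable)

end

section \<open>Nonseparable subgraphs and separations at a cut vertex\<close>

section \<open>Blocks and cut vertices\<close>

text \<open>The property maximised in \<open>is_block\<close>. One-vertex graphs and single edges
  have it.\<close>

definition nonseparable :: "('a, 'b) pre_digraph \<Rightarrow> bool" where
  "nonseparable H \<longleftrightarrow> graph H \<and> connected H \<and> (\<nexists>v. cut_vertex H v)"

lemma is_block_iff:
  "is_block G B \<longleftrightarrow> subgraph B G \<and> nonseparable B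
    \<and> (\<forall>H. subgraph B H \<longrightarrow> subgraph H G \<longrightarrow> nonseparable H \<longrightarrow> H = B)"
  unfolding is_block_def pre_digraph.max_subgraph_def nonseparable_def by blast

lemma subgraph_antisym: "subgraph G H \<Longrightarrow> subgraph H G \<Longrightarrow> G = H"
  by (auto simp: subgraph_def compatible_def)

lemma blocks_nonseparable:
  assumes "nonseparable G"
  shows "{B. is_block G B} = {G}"
proof -
  interpret graph G using assms by (simp add: nonseparable_def)
  show ?thesis
    using assms subgraph_refl by (auto simp: is_block_iff dest: subgraph_antisym)
qed

context graph begin

text \<open>Deleting either end leaves one vertex, and a one-vertex graph is connected.\<close>

lemma nonseparable_edge:
  assumes "x \<rightarrow>\<^bsub>G\<^esub> y"
  shows "nonseparable (G \<restriction> {x, y})"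
proof -
  let ?H = "G \<restriction> {x, y}"
  have xy: "x \<in> verts G" "y \<in> verts G" "x \<noteq> y"
    using assms adj_in_verts adj_not_same by auto
  interpret H: graph ?H
    using xy by (intro graph_induce_subgraph) auto
  have "x \<rightarrow>\<^bsub>?H\<^esub> y" using assms by (auto simp: arcs_ends_conv)
  then have "x \<rightarrow>\<^sup>*\<^bsub>?H\<^esub> y" "y \<rightarrow>\<^sup>*\<^bsub>?H\<^esub> x"
    using H.symmetric_reachable' by blast+
  then have "connected ?H"
    by (auto simp: H.connected_iff_reachable)
  moreover have "connected (H.del_vert v)" if "v \<in> {x, y}" for v
  proof -
    have "verts (H.del_vert v) = {if v = x then y else x}"
      using that xy(3) by (auto simp: H.verts_del_vert)
    then show ?thesis
      using graph.connected_singleton[OF H.graph_del_vert] by blast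
  qed
  ultimately show ?thesis
    using H.graph_axioms by (auto simp: nonseparable_def cut_vertex_def)
qed

text \<open>By connectedness a lone vertex \<open>x\<close> has a neighbour, and the edge between
  them is a larger nonseparable subgraph. This later forces each block into exactly one side of a
  separation.\<close>

lemma block_not_subsingleton:
  assumes conn: "connected G" and two: "\<not> verts G \<subseteq> {x}" and B: "is_block G B"
  shows "\<not> verts B \<subseteq> {x}"
proof
  assume sub: "verts B \<subseteq> {x}"
  have sB: "subgraph B G" and nB: "nonseparable B"
    using B by (auto simp: is_block_iff)
  then interpret B: graph B by (simp add: nonseparable_def)
  have vB: "verts B = {x}"
    using sub nB by (auto simp: nonseparable_def B.connected_iff_reachable)
  then have "x \<in> verts G" using sB by auto
  moreover obtain y where y: "y \<in> verts G" "y \<noteq> x" using two by auto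
  ultimately have "x \<rightarrow>\<^sup>*\<^bsub>G\<^esub> y" using conn by (simp add: connected_iff_reachable)
  then obtain z where z: "x \<rightarrow>\<^bsub>G\<^esub> z"
    using y(2) by (cases rule: converse_reachable_cases) auto
  let ?H = "G \<restriction> {x, z}"
  have "arcs B = {}"
    using B.tail_in_verts B.head_in_verts B.no_loops vB by fastforce
  then have "subgraph B ?H"
    using vB sB by (auto simp: subgraph_def compatible_def)
  moreover have "subgraph ?H G"
    using adj_in_verts[OF z] by (intro subgraph_induce_subgraphI) auto
  ultimately have "?H = B"
    using B nonseparable_edge[OF z] unfolding is_block_iff by blast
  then have "z = x"
    using vB by (metis induce_subgraph_verts insertI1 insert_commute singletonD)
  then show False using z adj_not_same by blast
qed

end

text \<open>A separation at \<open>v\<close> stated symmetrically in \<open>S\<close> and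
  \<open>T\<close>, instead of through components, so that facts about \<open>S\<close> carry over
  to \<open>T\<close> by \<open>swap\<close>. By \<open>proper\<close> both sides are smaller than
  the graph, which drives the induction.\<close>

locale vertex_split = graph +
  fixes v :: 'a and S T :: "'a set"
  assumes conn: "connected G"
    and Un: "S \<union> T = verts G" and Int: "S \<inter> T = {v}"
    and no_cross: "\<And>x y. x \<rightarrow>\<^bsub>G\<^esub> y \<Longrightarrow> x \<in> S \<and> y \<in> S \<or> x \<in> T \<and> y \<in> T"
    and proper: "S \<noteq> {v}" "T \<noteq> {v}"
begin

lemma swap: "vertex_split G v T S"
proof unfold_locales
  show "x \<in> T \<and> y \<in> T \<or> x \<in> S \<and> y \<in> S" if "x \<rightarrow>\<^bsub>G\<^esub> y" for x y
    using no_cross[OF that] by blast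
qed (use conn Un Int proper in auto)

lemma part_subset: "S \<subseteq> verts G"
  using Un by auto

lemma cut_in_part: "v \<in> S" "v \<in> T"
  using Int by auto

lemma in_both: "x \<in> S \<Longrightarrow> x \<in> T \<Longrightarrow> x = v"
  using Int by blast

lemma graph_part: "graph (G \<restriction> S)"
  using part_subset by (rule graph_induce_subgraph)

lemma reach: "x \<in> verts G \<Longrightarrow> y \<in> verts G \<Longrightarrow> x \<rightarrow>\<^sup>*\<^bsub>G\<^esub> y"
  using conn by (simp add: connected_iff_reachable)

lemma adj_part: "x \<rightarrow>\<^bsub>G\<^esub> y \<Longrightarrow> x \<in> S \<Longrightarrow> y \<in> S \<Longrightarrow> x \<rightarrow>\<^bsub>G \<restriction> S\<^esub> y"
  by (auto simp: arcs_ends_conv)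

text \<open>The retraction onto \<open>S\<close> that sends every vertex outside \<open>S\<close> to
  \<open>v\<close> maps each arc to an arc of the part or to a single vertex, hence walks to
  walks.\<close>

lemma reach_part:
  assumes "x \<in> S" "y \<in> S"
  shows "x \<rightarrow>\<^sup>*\<^bsub>G \<restriction> S\<^esub> y"
proof -
  interpret H: graph "G \<restriction> S" by (rule graph_part)
  have "x \<rightarrow>\<^sup>*\<^bsub>G\<^esub> y" using assms part_subset by (intro reach) auto
  then have "x \<rightarrow>\<^sup>*\<^bsub>G \<restriction> S\<^esub> (if y \<in> S then y else v)"
  proof (induction rule: reachable_induct)
    case (step y z)
    show ?case
    proof (cases "y \<in> S \<and> z \<in> S")
      case True
      then have "x \<rightarrow>\<^sup>*\<^bsub>G \<restriction> S\<^esub> y" "y \<rightarrow>\<^bsub>G \<restriction> S\<^esub> z"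
        using step.IH adj_part[OF step.hyps(2)] by simp_all
      then have "x \<rightarrow>\<^sup>*\<^bsub>G \<restriction> S\<^esub> z" by (rule H.reachable_adj_trans)
      then show ?thesis using True by simp
    next
      case False
      then have "y \<in> T" "z \<in> T" "y \<notin> S \<or> z \<notin> S"
        using no_cross[OF step.hyps(2)] by blast+
      then have "(if z \<in> S then z else v) = (if y \<in> S then y else v)"
        using in_both by metis
      then show ?thesis using step.IH by simp
    qed
  qed (simp add: assms)
  then show ?thesis using assms by simp
qed

lemma connected_part: "connected (G \<restriction> S)"
  unfolding graph.connected_iff_reachable[OF graph_part] using cut_in_part(1)
  by (auto intro!: reach_part)

lemma graph_dist_part:
  assumes x: "x \<in> S" and y: "y \<in> S"
  shows "graph_dist (G \<restriction> S) x y = graph_dist G x y"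
proof (rule antisym)
  interpret H: graph "G \<restriction> S" by (rule graph_part)
  let ?d = "graph_dist (G \<restriction> S)"
  \<comment> \<open>The distance inside the part, composed with the retraction onto
    \<open>S\<close>: it stays constant along arcs that leave the part, so it grows by at most one
    per arc of \<open>G\<close>.\<close>
  let ?f = "\<lambda>z. if z \<in> S then ?d x z else ?d x v"
  have step: "?f z \<le> ?f w + 1" if "w \<rightarrow>\<^bsub>G\<^esub> z" for w z
  proof (cases "w \<in> S \<and> z \<in> S")
    case True
    then show ?thesis
      using H.graph_dist_step[OF reach_part[OF x] adj_part[OF that]] by simp
  next
    case False
    then have "?f z = ?f w" using no_cross[OF that] in_both cut_in_part by metis
    then show ?thesis by simp
  qed
  have "x \<rightarrow>\<^sup>*\<^bsub>G\<^esub> y" using x y part_subset by (intro reach) auto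
  moreover have "?f x = 0" using x H.graph_dist_self by simp
  ultimately have "?f y \<le> graph_dist G x y"
    using step by (rule Lipschitz_le_graph_dist)
  then show "?d x y \<le> graph_dist G x y" using y by simp
  have "(x, z) \<in> arcs_ends G ^^ k" if "(x, z) \<in> arcs_ends (G \<restriction> S) ^^ k" for k z
    using that by (induction k arbitrary: z) (auto dest: dominates_induce_subgraphD)
  then have "(x, y) \<in> arcs_ends G ^^ ?d x y"
    using H.reachable_relpow[OF reach_part[OF x y]] by blast
  then show "graph_dist G x y \<le> ?d x y"
    using x part_subset by (intro graph_dist_relpow(2)) auto
qed

lemma graph_dist_cross:
  assumes x: "x \<in> S" and y: "y \<in> T"
  shows "graph_dist G x y = graph_dist G x v + graph_dist G v y"
proof (rule antisym)
  let ?d = "graph_dist G"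
  have V: "x \<in> verts G" "y \<in> verts G" "v \<in> verts G" using x y Un Int by auto
  then show "?d x y \<le> ?d x v + ?d v y"
    by (intro graph_dist_triangle reach)
  \<comment> \<open>The expected distance from \<open>x\<close>. Its two branches agree at
    \<open>v\<close>, the only vertex on both sides, so the second formula is valid on all of
    \<open>T\<close>.\<close>
  let ?f = "\<lambda>z. if z \<in> S then ?d x z else ?d x v + ?d v z"
  have f_T: "?f z = ?d x v + ?d v z" if "z \<in> T" for z
    using that in_both[of z] graph_dist_self[OF V(3)] by auto
  have step: "?f z \<le> ?f w + 1" if wz: "w \<rightarrow>\<^bsub>G\<^esub> z" for w z
    using no_cross[OF wz]
  proof
    assume "w \<in> S \<and> z \<in> S"
    then show ?thesis
      using graph_dist_step[OF reach wz, of x] V adj_in_verts[OF wz] by simp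
  next
    assume "w \<in> T \<and> z \<in> T"
    then show ?thesis
      using graph_dist_step[OF reach wz, of v] V adj_in_verts[OF wz] f_T[of w] f_T[of z] by linarith
  qed
  have "?f x = 0" using x graph_dist_self[OF V(1)] by simp
  then have "?f y \<le> ?d x y"
    using step by (rule Lipschitz_le_graph_dist[OF reach[OF V(1,2)]])
  then show "?d x v + ?d v y \<le> ?d x y" using f_T[OF y] by simp
qed

text \<open>Otherwise \<open>H\<close> has vertices \<open>a\<close> and \<open>b\<close> strictly
  on different sides. Since \<open>v\<close> is not a cut vertex of \<open>H\<close>, they remain
  connected without \<open>v\<close>, but a walk avoiding \<open>v\<close> cannot change
  sides.\<close>

lemma nonseparable_subgraph:
  assumes sub: "subgraph H G" and H: "nonseparable H"
  shows "verts H \<subseteq> S \<or> verts H \<subseteq> T"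
proof (rule ccontr)
  assume "\<not> (verts H \<subseteq> S \<or> verts H \<subseteq> T)"
  then obtain a b where ab: "a \<in> verts H" "a \<notin> T" "b \<in> verts H" "b \<notin> S" by auto
  interpret H: graph H using H by (simp add: nonseparable_def)
  define K where "K = H.del_vert v"
  interpret K: graph K unfolding K_def by (rule H.graph_del_vert)
  have vK: "verts K = verts H - {v}"
    by (simp add: K_def H.verts_del_vert)
  then have abK: "a \<in> verts K" "b \<in> verts K"
    using ab cut_in_part by auto
  have "connected K"
  proof (cases "v \<in> verts H")
    case True
    moreover have "\<not> cut_vertex H v"
      using H by (simp add: nonseparable_def)
    ultimately show ?thesis
      using abK unfolding cut_vertex_def K_def by auto
  next
    case False
    then have "K = H"
      unfolding K_def by (intro pre_digraph.equality) (auto simp: H.del_vert_simps)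
    then show ?thesis using H by (simp add: nonseparable_def)
  qed
  then have "a \<rightarrow>\<^sup>*\<^bsub>K\<^esub> b"
    using abK by (simp add: K.connected_iff_reachable)
  then have "b \<in> S"
  proof (induction rule: K.reachable_induct)
    case base
    then show ?case using ab sub Un by auto
  next
    case (step x y)
    have "x \<noteq> v" using K.adj_in_verts[OF step.hyps(2)] vK by auto
    moreover have "x \<rightarrow>\<^bsub>G\<^esub> y"
      using step.hyps(2) sub unfolding K_def arcs_ends_conv
      by (auto simp: H.del_vert_simps subgraph_def compatible_def)
    ultimately show ?case using no_cross[of x y] step.IH in_both by blast
  qed
  then show False using ab by simp
qed

lemma subgraph_part_iff: "subgraph H (G \<restriction> S) \<longleftrightarrow> subgraph H G \<and> verts H \<subseteq> S"
proof
  assume H: "subgraph H (G \<restriction> S)"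
  then show "subgraph H G \<and> verts H \<subseteq> S"
    using subgraph_trans[OF H subgraph_induce_subgraphI[OF part_subset]] subgraph_imp_subverts[OF H]
    by simp
next
  assume "subgraph H G \<and> verts H \<subseteq> S"
  then show "subgraph H (G \<restriction> S)"
  proof (elim conjE)
    assume H: "subgraph H G" "verts H \<subseteq> S"
    then have "subgraph (G \<restriction> verts H) (G \<restriction> S)"
      by (intro subgraphI wellformed_induce_subgraph) (auto simp: compatible_def)
    then show ?thesis
      using subgraph_induce_subgraphI2[OF H(1)] subgraph_trans by blast
  qed
qed

text \<open>A block of the part has a vertex other than \<open>v\<close>, so a nonseparable subgraph
  of \<open>G\<close> containing it cannot lie in \<open>T\<close> and must lie in \<open>S\<close>;
  maximality therefore passes from the part to \<open>G\<close>.\<close>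

lemma is_block_part_iff: "is_block (G \<restriction> S) B \<longleftrightarrow> is_block G B \<and> verts B \<subseteq> S"
proof
  assume B: "is_block (G \<restriction> S) B"
  interpret P: graph "G \<restriction> S" by (rule graph_part)
  have "\<not> S \<subseteq> {v}" using proper cut_in_part by auto
  then have nv: "\<not> verts B \<subseteq> {v}"
    using P.block_not_subsingleton[OF connected_part _ B] by simp
  have sB: "subgraph B G" "verts B \<subseteq> S" "nonseparable B"
    using B by (auto simp: is_block_iff subgraph_part_iff)
  have "H = B" if H: "subgraph B H" "subgraph H G" "nonseparable H" for H
  proof -
    have "verts H \<subseteq> S \<or> verts H \<subseteq> T"
      using H by (intro nonseparable_subgraph)
    moreover have "\<not> verts H \<subseteq> T"
      using subgraph_imp_subverts[OF H(1)] nv sB(2) in_both by blast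
    ultimately have "subgraph H (G \<restriction> S)"
      using H(2) by (simp add: subgraph_part_iff)
    then show ?thesis
      using B H(1,3) by (simp add: is_block_iff)
  qed
  then show "is_block G B \<and> verts B \<subseteq> S"
    using sB by (auto simp: is_block_iff)
next
  assume "is_block G B \<and> verts B \<subseteq> S"
  then show "is_block (G \<restriction> S) B"
    by (auto simp: is_block_iff subgraph_part_iff)
qed

lemma blocks_Un: "{B. is_block G B} = {B. is_block (G \<restriction> S) B} \<union> {B. is_block (G \<restriction> T) B}"
proof -
  have "verts B \<subseteq> S \<or> verts B \<subseteq> T" if "is_block G B" for B
    using that by (intro nonseparable_subgraph) (auto simp: is_block_iff)
  then show ?thesis
    unfolding is_block_part_iff vertex_split.is_block_part_iff[OF swap] by blast
qed

text \<open>A common block would have no vertex but \<open>v\<close>, against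
  \<open>block_not_subsingleton\<close>.\<close>

lemma blocks_disjoint: "{B. is_block (G \<restriction> S) B} \<inter> {B. is_block (G \<restriction> T) B} = {}"
proof -
  have "\<not> S \<subseteq> {v}" using proper cut_in_part by auto
  then have "\<not> verts B \<subseteq> {v}" if "is_block (G \<restriction> S) B" for B
    using graph.block_not_subsingleton[OF graph_part connected_part _ that] by simp
  moreover have "verts B \<subseteq> {v}" if "is_block (G \<restriction> S) B" "is_block (G \<restriction> T) B" for B
    using that in_both unfolding is_block_part_iff vertex_split.is_block_part_iff[OF swap] by blast
  ultimately show ?thesis by blast
qed

end

lemma (in graph) cut_vertex_split:
  assumes conn: "connected G" and cut: "cut_vertex G v"
  obtains S T where "vertex_split G v S T"
proof -
  let ?H = "del_vert v"
  interpret H: graph ?H by (rule graph_del_vert)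
  have vH: "verts ?H = verts G - {v}" by (simp add: verts_del_vert)
  have "verts ?H \<noteq> {}" "\<not> connected ?H"
    using cut by (simp_all add: cut_vertex_def)
  then obtain a b where ab: "a \<in> verts ?H" "b \<in> verts ?H" "\<not> a \<rightarrow>\<^sup>*\<^bsub>?H\<^esub> b"
    by (auto simp: H.connected_iff_reachable)
  \<comment> \<open>\<open>S\<close> is the component of \<open>a\<close> after deleting
    \<open>v\<close>, with \<open>v\<close> restored. \<open>T\<close> contains \<open>v\<close>
    too, because \<open>v\<close> is not reachable in the graph without it.\<close>
  define S where "S = insert v {x. a \<rightarrow>\<^sup>*\<^bsub>?H\<^esub> x}"
  define T where "T = verts G - {x. a \<rightarrow>\<^sup>*\<^bsub>?H\<^esub> x}"
  have vG: "v \<in> verts G" using cut by (simp add: cut_vertex_def)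
  have reachH: "x \<in> verts G" "x \<noteq> v" if "a \<rightarrow>\<^sup>*\<^bsub>?H\<^esub> x" for x
    using H.reachable_in_verts(2)[OF that] vH by auto
  have step: "a \<rightarrow>\<^sup>*\<^bsub>?H\<^esub> y" if "x \<rightarrow>\<^bsub>G\<^esub> y" "a \<rightarrow>\<^sup>*\<^bsub>?H\<^esub> x" "y \<noteq> v" for x y
  proof -
    have "x \<rightarrow>\<^bsub>?H\<^esub> y"
      using that(1,3) reachH(2)[OF that(2)] by (auto simp: arcs_ends_conv del_vert_simps)
    with that(2) show ?thesis by (rule H.reachable_adj_trans)
  qed
  have "vertex_split G v S T"
  proof unfold_locales
    show "S \<union> T = verts G" "S \<inter> T = {v}"
      using vG reachH unfolding S_def T_def by blast+
    have "a \<in> S" "b \<in> T" "a \<noteq> v" "b \<noteq> v"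
      using ab vH H.reachable_refl[OF ab(1)] unfolding S_def T_def by blast+
    then show "S \<noteq> {v}" "T \<noteq> {v}" by blast+
    show "x \<in> S \<and> y \<in> S \<or> x \<in> T \<and> y \<in> T" if "x \<rightarrow>\<^bsub>G\<^esub> y" for x y
      using step[OF that] step[OF arcs_ends_symmetric[OF sym_arcs that]] adj_in_verts[OF that]
      unfolding S_def T_def by blast
  qed (rule conn)
  then show thesis by (rule that)
qed

section \<open>Behaviour of the two invariants at a cut vertex, and induction over the
  blocks\<close>

section \<open>Gluing at a cut vertex\<close>

text \<open>The chosen ordering is immaterial by \<open>kdet_reorder\<close>. A value attached to
  the graph alone allows sums and products over the set of blocks.\<close>

definition q_det_of :: "'k::comm_ring_1 \<Rightarrow> ('a, 'b) pre_digraph \<Rightarrow> 'k" where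
  "q_det_of q G = kdet (\<lambda>x y. q_num q (graph_dist G x y)) (SOME vs. vertex_ordering G vs)"

text \<open>
  By \<open>kdet_xi_kernel\<close> this is \<open>q_xi\<close>, in a form that shows that it depends neither on the base vertex nor
  on the ordering of the vertices.
\<close>

definition q_xi_of :: "'k::comm_ring_1 \<Rightarrow> ('a, 'b) pre_digraph \<Rightarrow> 'k" where
  "q_xi_of q G = kdet (\<lambda>x y. q_num q (graph_dist G x y) + 1) (SOME vs. vertex_ordering G vs)
    + (q - 2) * q_det_of q G"

lemma kdet_some_ordering:
  assumes "vertex_ordering G vs"
  shows "kdet f (SOME vs. vertex_ordering G vs) = kdet f vs"
proof -
  have "vertex_ordering G (SOME vs. vertex_ordering G vs)"
    using assms by (rule someI)
  then show ?thesis
    using assms by (intro kdet_reorder) (auto simp: vertex_ordering_def)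
qed

lemma q_det_of_eq_kdet:
  "vertex_ordering G vs \<Longrightarrow> q_det_of q G = kdet (\<lambda>x y. q_num q (graph_dist G x y)) vs"
  unfolding q_det_of_def by (rule kdet_some_ordering)

lemma det_q_distance_matrix:
  assumes "vertex_ordering G vs"
  shows "det (q_distance_matrix q G vs) = q_det_of q G"
  unfolding q_det_of_eq_kdet[OF assms] by (simp add: q_distance_matrix_def kdet_def)

lemma q_xi_of_eq_kdet:
  fixes q :: "'k::idom"
  assumes "wf_digraph G" "vertex_ordering G (v # xs)"
  shows "q_xi_of q G = kdet (xi_kernel q (graph_dist G) v) xs"
proof -
  have "v \<in> verts G" "v \<notin> set xs" "distinct xs"
    using assms(2) by (auto simp: vertex_ordering_def)
  then show ?thesis
    using wf_digraph.graph_dist_self[OF assms(1)] kdet_some_ordering[OF assms(2)]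
    by (simp add: q_xi_of_def q_det_of_eq_kdet[OF assms(2)] kdet_xi_kernel)
qed

lemma q_xi_eq_q_xi_of:
  fixes q :: "'k::idom"
  assumes "wf_digraph G" "verts G \<noteq> {}" "vertex_ordering G vs"
  shows "q_xi q G vs = q_xi_of q G"
proof -
  obtain v xs where vs: "vs = v # xs"
    using assms(2,3) by (cases vs) (auto simp: vertex_ordering_def)
  have "q_xi q G vs = kdet (xi_kernel q (graph_dist G) v) xs"
    unfolding q_xi_def kdet_def vs
    by (rule arg_cong[where f = det], rule eq_matI)
      (auto simp: mat_delete_def q_distance_matrix_def xi_kernel_def)
  then show ?thesis
    using q_xi_of_eq_kdet[of G v xs q] assms vs by simp
qed

context vertex_split begin

text \<open>\<open>v\<close> serves as base vertex for \<open>G\<close> and both parts, which is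
  legitimate as \<open>q_xi_of\<close> is independent of the base. Distances agree with those of the
  parts and add up across \<open>v\<close>, so the kernel identities apply.\<close>

lemma q_glue:
  fixes q :: "'k::idom"
  shows "q_det_of q G = q_det_of q (G \<restriction> S) * q_xi_of q (G \<restriction> T) + q_xi_of q (G \<restriction> S) * q_det_of q (G \<restriction> T)"
    and "q_xi_of q G = q_xi_of q (G \<restriction> S) * q_xi_of q (G \<restriction> T)"
proof -
  let ?d = "graph_dist G"
  note swapped = vertex_split.graph_dist_part[OF swap] vertex_split.graph_dist_cross[OF swap]
  have "finite (S \<union> T)" unfolding Un by simp
  then have "finite (S - {v})" "finite (T - {v})" by simp_all
  obtain xs where xs: "set xs = S - {v}" "distinct xs"
    using finite_distinct_list[OF \<open>finite (S - {v})\<close>] by blast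
  obtain ys where ys: "set ys = T - {v}" "distinct ys"
    using finite_distinct_list[OF \<open>finite (T - {v})\<close>] by blast
  have oS: "vertex_ordering (G \<restriction> S) (v # xs)" and oT: "vertex_ordering (G \<restriction> T) (v # ys)"
    using xs ys cut_in_part by (auto simp: vertex_ordering_def)
  have disj: "set xs \<inter> set ys = {}"
    using xs ys in_both by blast
  have "set (v # xs @ ys) = S \<union> T"
    unfolding set_simps set_append xs(1) ys(1) using cut_in_part by blast
  then have oG: "vertex_ordering G (v # xs @ ys)"
    using xs(2) ys(2) disj Un by (simp add: vertex_ordering_def xs(1) ys(1))
  have vv: "?d v v = 0"
    using cut_in_part(1) part_subset by (intro graph_dist_self) blast
  have cross: "?d x y = ?d x v + ?d v y" "?d y x = ?d y v + ?d v x"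
    if "x \<in> set xs" "y \<in> set ys" for x y
    using that xs ys by (auto intro: graph_dist_cross swapped(2))
  have sub: "set (v # xs) \<subseteq> S" "set (v # ys) \<subseteq> T"
    using xs(1) ys(1) cut_in_part by auto
  have dS: "graph_dist (G \<restriction> S) x y = ?d x y" if "x \<in> set (v # xs)" "y \<in> set (v # xs)" for x y
    using that sub(1) by (intro graph_dist_part) blast+
  have dT: "graph_dist (G \<restriction> T) x y = ?d x y" if "x \<in> set (v # ys)" "y \<in> set (v # ys)" for x y
    using that sub(2) by (intro swapped(1)) blast+
  have detS: "q_det_of q (G \<restriction> S) = kdet (\<lambda>x y. q_num q (?d x y)) (v # xs)"
    unfolding q_det_of_eq_kdet[OF oS]
    by (rule kdet_cong) (simp_all only: dS)
  have detT: "q_det_of q (G \<restriction> T) = kdet (\<lambda>x y. q_num q (?d x y)) (v # ys)"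
    unfolding q_det_of_eq_kdet[OF oT]
    by (rule kdet_cong) (simp_all only: dT)
  have xiS: "q_xi_of q (G \<restriction> S) = kdet (xi_kernel q ?d v) xs"
    unfolding q_xi_of_eq_kdet[OF wellformed_induce_subgraph oS]
    by (rule kdet_cong) (simp_all add: dS xi_kernel_def)
  have xiT: "q_xi_of q (G \<restriction> T) = kdet (xi_kernel q ?d v) ys"
    unfolding q_xi_of_eq_kdet[OF wellformed_induce_subgraph oT]
    by (rule kdet_cong) (simp_all add: dT xi_kernel_def)
  have "distinct (v # xs @ ys)" using oG by (simp add: vertex_ordering_def)
  from kdet_q_num_glue[where d = ?d and q = q, OF this vv cross]
  show "q_det_of q G = q_det_of q (G \<restriction> S) * q_xi_of q (G \<restriction> T) + q_xi_of q (G \<restriction> S) * q_det_of q (G \<restriction> T)"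
    unfolding q_det_of_eq_kdet[OF oG] detS detT xiS xiT by (simp only: mult.commute)
  have "xi_kernel q ?d v x y = 0" if "x \<in> set xs" "y \<in> set ys" for x y
    using cross(1)[OF that] by (simp add: xi_kernel_def)
  then show "q_xi_of q G = q_xi_of q (G \<restriction> S) * q_xi_of q (G \<restriction> T)"
    unfolding q_xi_of_eq_kdet[OF wf_digraph oG] xiS xiT by (rule kdet_append)
qed

lemma card_part_less: "card S < card (verts G)"
proof (rule psubset_card_mono)
  show "S \<subset> verts G"
    using Un in_both proper(2) cut_in_part by blast
qed simp

end

text \<open>A Leibniz rule: the distinguished factor lies in \<open>A\<close> or in
  \<open>B\<close>. It has the shape of the recursion for \<open>q_det_of\<close> in
  \<open>q_glue\<close>.\<close>

lemma sum_prod_Un_disjoint: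
  fixes f g :: "'a \<Rightarrow> 'k::comm_ring_1"
  assumes fin: "finite A" "finite B" and disj: "A \<inter> B = {}"
  shows "(\<Sum>x\<in>A \<union> B. f x * (\<Prod>y\<in>A \<union> B - {x}. g y))
    = (\<Sum>x\<in>A. f x * (\<Prod>y\<in>A - {x}. g y)) * prod g B + prod g A * (\<Sum>x\<in>B. f x * (\<Prod>y\<in>B - {x}. g y))"
proof -
  have "(\<Prod>y\<in>A \<union> B - {x}. g y) = (\<Prod>y\<in>A - {x}. g y) * prod g B" if "x \<in> A" for x
  proof -
    have "A \<union> B - {x} = (A - {x}) \<union> B" using that disj by blast
    then show ?thesis using fin disj by (simp add: prod.union_disjoint Diff_Int_distrib2)
  qed
  moreover have "(\<Prod>y\<in>A \<union> B - {x}. g y) = prod g A * (\<Prod>y\<in>B - {x}. g y)" if "x \<in> B" for x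
  proof -
    have "A \<union> B - {x} = A \<union> (B - {x})" using that disj by blast
    then show ?thesis using fin disj by (simp add: prod.union_disjoint Diff_Int_distrib)
  qed
  ultimately show ?thesis
    by (simp add: sum.union_disjoint[OF fin disj] sum_distrib_left sum_distrib_right mult_ac)
qed

text \<open>Induction on the number of vertices: a graph without cut vertex is its own only block,
  and a split divides the blocks into those of the two parts. Finiteness is carried along since the
  rules for disjoint unions require it.\<close>

theorem q_det_xi_blocks:
  fixes q :: "'k::idom"
  assumes "graph G" "connected G"
  shows "finite {B. is_block G B}
    \<and> q_xi_of q G = (\<Prod>B\<in>{B. is_block G B}. q_xi_of q B)
    \<and> q_det_of q G = (\<Sum>B\<in>{B. is_block G B}. q_det_of q B * (\<Prod>C\<in>{B. is_block G B} - {B}. q_xi_of q C))"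
    (is "?P G")
  using assms
proof (induction "card (verts G)" arbitrary: G rule: less_induct)
  case less
  then interpret graph G by simp
  show ?case
  proof (cases "\<exists>v. cut_vertex G v")
    case False
    then have "{B. is_block G B} = {G}"
      using less.prems by (intro blocks_nonseparable) (simp add: nonseparable_def)
    then show ?thesis by simp
  next
    case True
    then obtain v S T where "vertex_split G v S T"
      using cut_vertex_split less.prems(2) by metis
    then interpret vertex_split G v S T .
    interpret swapped: vertex_split G v T S by (rule swap)
    have "?P (G \<restriction> S)"
      using card_part_less by (intro less.hyps graph_part connected_part) simp
    moreover have "?P (G \<restriction> T)"
      using swapped.card_part_less
      by (intro less.hyps swapped.graph_part swapped.connected_part) simp
    ultimately show ?thesis
      unfolding blocks_Un q_glue(1) q_glue(2)
      using sum_prod_Un_disjoint[OF _ _ blocks_disjoint, of "q_det_of q" "q_xi_of q"]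
      by (simp add: prod.union_disjoint[OF _ _ blocks_disjoint])
  qed
qed

section \<open>Distances and both invariants of a single complete bipartite block\<close>

section \<open>Complete bipartite graphs\<close>

lemma complete_bipartite_graph_dist:
  assumes "complete_bipartite_digraph m n H" "1 \<le> m" "1 \<le> n"
  shows "\<exists>U V. verts H = U \<union> V \<and> U \<inter> V = {} \<and> card U = m \<and> card V = n
    \<and> (\<forall>x\<in>verts H. \<forall>y\<in>verts H.
      graph_dist H x y = (if x = y then 0 else if x \<in> U \<longleftrightarrow> y \<in> U then 2 else 1))"
proof -
  obtain U V where UV: "verts H = U \<union> V" "U \<inter> V = {}" "card U = m" "card V = n"
    and E: "arcs_ends H = U \<times> V \<union> V \<times> U" and "graph H"
    using assms(1) unfolding complete_bipartite_digraph_def by blast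
  interpret graph H by fact
  have "U \<noteq> {}" "V \<noteq> {}"
    using UV(3,4) assms(2,3) by force+
  then obtain u v where uv: "u \<in> U" "v \<in> V" by blast
  have "graph_dist H x y = (if x = y then 0 else if x \<in> U \<longleftrightarrow> y \<in> U then 2 else 1)"
    if xy: "x \<in> verts H" "y \<in> verts H" for x y
  proof (cases "x = y")
    case True
    then show ?thesis using xy graph_dist_self by simp
  next
    case neq: False
    have xyUV: "x \<in> U \<or> x \<in> V" "y \<in> U \<or> y \<in> V"
      using xy UV(1) by blast+
    \<comment> \<open>The distance is an exponent that relates \<open>x\<close> to \<open>y\<close>;
      ruling out the smaller exponents leaves only the upper bound.\<close>
    have ne: "graph_dist H x y \<noteq> k"
      if "(x, y) \<in> arcs_ends H ^^ graph_dist H x y" "(x, y) \<notin> arcs_ends H ^^ k" for k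
    proof
      assume "graph_dist H x y = k"
      with that show False by simp
    qed
    have ne0: "(x, y) \<notin> arcs_ends H ^^ 0" using neq by simp
    show ?thesis
    proof (cases "x \<in> U \<longleftrightarrow> y \<in> U")
      case True
      \<comment> \<open>Any vertex of the opposite class is a common neighbour.\<close>
      let ?w = "if x \<in> U then v else u"
      have "(x, ?w) \<in> arcs_ends H" "(?w, y) \<in> arcs_ends H"
        unfolding E using xyUV True uv by (cases "x \<in> U"; simp)+
      then have "(x, y) \<in> arcs_ends H ^^ 2"
        unfolding numeral_2_eq_2 relpow.simps by blast
      note d = graph_dist_relpow[OF this xy(1)]
      have "(x, y) \<notin> arcs_ends H"
        unfolding E using True UV(2) by blast
      then have "(x, y) \<notin> arcs_ends H ^^ 1" by simp
      then show ?thesis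
        using ne[OF d(1) ne0] ne[OF d(1), of 1] d(2) neq True by simp
    next
      case False
      then have "(x, y) \<in> arcs_ends H ^^ 1"
        using xyUV by (auto simp: E)
      note d = graph_dist_relpow[OF this xy(1)]
      show ?thesis
        using ne[OF d(1) ne0] d(2) neq False by simp
    qed
  qed
  with UV show ?thesis
    by (intro exI[of _ U] exI[of _ V] conjI ballI)
qed

text \<open>Distances depend only on the classes, up to the diagonal, so
  \<open>kdet_two_classes\<close> applies; \<open>q \<noteq> -1\<close> makes
  \<open>s = q + 1\<close> nonzero. The sign exponent of \<open>q_xi_of\<close> is
  \<open>m + n\<close>, not \<open>m + n - 1\<close>: for a single edge the defining matrix has the
  one entry \<open>- q_num q 2\<close>, so the value is \<open>- (q + 1)\<close>.\<close>

lemma complete_bipartite_q_det_xi: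
  fixes q :: "'k::idom"
  assumes H: "complete_bipartite_digraph m n H" and mn: "1 \<le> m" "1 \<le> n" and q: "q \<noteq> -1"
  shows "q_det_of q H = (-1) ^ (m + n - 2) * (q + 1) ^ (m + n - 2)
      * ((q + 1) ^ 2 * (of_nat m - 1) * (of_nat n - 1) - of_nat m * of_nat n)" (is ?det)
    and "q_xi_of q H = (-1) ^ (m + n) * (q + 1) ^ (m + n - 1)
      * (q ^ 2 * (of_nat m - 1) * (of_nat n - 1) - 1)" (is ?xi)
proof -
  obtain U V where UV: "verts H = U \<union> V" "U \<inter> V = {}" "card U = m" "card V = n"
    and dist: "\<And>x y. \<lbrakk>x \<in> verts H; y \<in> verts H\<rbrakk> \<Longrightarrow>
      graph_dist H x y = (if x = y then 0 else if x \<in> U \<longleftrightarrow> y \<in> U then 2 else 1)"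
    using complete_bipartite_graph_dist[OF H mn] by blast
  interpret graph H using H by (simp add: complete_bipartite_digraph_def)
  obtain ws where ws: "set ws = verts H" "distinct ws"
    using finite_distinct_list[OF finite_verts] by blast
  then have ord: "vertex_ordering H ws" by (simp add: vertex_ordering_def)
  let ?s = "q + 1"
  have s: "?s \<noteq> 0" using q by (simp add: eq_neg_iff_add_eq_0)
  let ?p = "(- ?s) ^ (m + n - 2)"
  \<comment> \<open>Here \<open>a = q + 1\<close> and \<open>b = 1\<close>, the
    \<open>q\<close>-numbers of 2 and 1, and \<open>s = a\<close> produces the zero
    diagonal.\<close>
  have det: "q_det_of q H
      = ?p * ((of_nat m * ?s - ?s) * (of_nat n * ?s - ?s) - of_nat m * of_nat n * 1\<^sup>2)"
    unfolding q_det_of_eq_kdet[OF ord]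
    using ws UV mn s
    by (intro kdet_two_classes) (auto simp: dist q_num_def numeral_2_eq_2)
  \<comment> \<open>Adding 1 to every entry changes \<open>a\<close> to \<open>q + 2\<close> and
    \<open>b\<close> to 2, with the same \<open>s\<close>.\<close>
  have det1: "kdet (\<lambda>x y. q_num q (graph_dist H x y) + 1) ws
      = ?p * ((of_nat m * (?s + 1) - ?s) * (of_nat n * (?s + 1) - ?s) - of_nat m * of_nat n * 2\<^sup>2)"
    using ws UV mn s
    by (intro kdet_two_classes) (auto simp: dist q_num_def numeral_2_eq_2)
  have p: "?p = (-1) ^ (m + n - 2) * ?s ^ (m + n - 2)"
    by (subst power_minus) simp
  show ?det
    unfolding det p by (simp add: algebra_simps power2_eq_square)
  have ident: "P * ((x * (?s + 1) - ?s) * (y * (?s + 1) - ?s) - x * y * 2\<^sup>2)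
      + (q - 2) * (P * ((x * ?s - ?s) * (y * ?s - ?s) - x * y * 1\<^sup>2))
    = P * (?s * (q\<^sup>2 * (x - 1) * (y - 1) - 1))" for P x y :: 'k
    by (simp add: algebra_simps power2_eq_square)
  have "q_xi_of q H = ?p * (?s * (q\<^sup>2 * (of_nat m - 1) * (of_nat n - 1) - 1))"
    unfolding q_xi_of_def kdet_some_ordering[OF ord] det1 det
    by (rule ident)
  also have "\<dots> = (-1) ^ (m + n) * ?s ^ (m + n - 1) * (q\<^sup>2 * (of_nat m - 1) * (of_nat n - 1) - 1)"
  proof -
    \<comment> \<open>The factor \<open>?s\<close> joins the power and the sign exponent is raised
      by 2; writing \<open>m + n\<close> through \<open>k\<close> avoids truncated
      subtraction.\<close>
    define k where "k = m + n - 2"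
    have "m + n = Suc (Suc k)" using mn by (simp add: k_def)
    then show ?thesis unfolding p by simp
  qed
  finally show ?xi .
qed

section \<open>Transfer from the set of blocks to the enumerated blocks with given orderings\<close>

theorem theorem5p1:
  fixes G :: "('a, 'b) pre_digraph"
    and B :: "nat \<Rightarrow> ('a, 'b) pre_digraph"
    and m n :: "nat \<Rightarrow> nat"
    and N r :: nat
    and vs :: "'a list"
    and ws :: "nat \<Rightarrow> 'a list"
    and q :: "'k::real_normed_field"
  assumes "bi_block_graph G"
    and "r > 1"
    and "bij_betw B {1..r} {H. is_block G H}"
    and "\<And>i. i \<in> {1..r} \<Longrightarrow> 1 \<le> m i \<and> 1 \<le> n i \<and> complete_bipartite_digraph (m i) (n i) (B i)"
    and "N = (\<Sum>i = 1..r. m i + n i) - r + 1"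
    and "card (verts G) = N"
    and "vertex_ordering G vs"
    and "\<And>i. i \<in> {1..r} \<Longrightarrow> vertex_ordering (B i) (ws i)"
    and "q \<noteq> -1"
  shows "q_xi q G vs =
           (\<Prod>i = 1..r. (-1) ^ (m i + n i) * (q + 1) ^ (m i + n i - 1)
              * (q ^ 2 * (of_nat (m i) - 1) * (of_nat (n i) - 1) - 1))
       \<and> det (q_distance_matrix q G vs) =
           (\<Sum>i = 1..r. det (q_distance_matrix q (B i) (ws i))
              * (\<Prod>j \<in> {1..r} - {i}. q_xi q (B j) (ws j)))
       \<and> (\<forall>i \<in> {1..r}. det (q_distance_matrix q (B i) (ws i)) =
             (-1) ^ (m i + n i - 2) * (q + 1) ^ (m i + n i - 2)
              * ((q + 1) ^ 2 * (of_nat (m i) - 1) * (of_nat (n i) - 1) - of_nat (m i) * of_nat (n i)))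
       \<and> (\<forall>j \<in> {1..r}. q_xi q (B j) (ws j) =
             (-1) ^ (m j + n j) * (q + 1) ^ (m j + n j - 1)
              * (q ^ 2 * (of_nat (m j) - 1) * (of_nat (n j) - 1) - 1))"
proof -
  have G: "graph G" "connected G"
    using assms(1) by (simp_all add: bi_block_graph_def)
  interpret graph G by (rule G(1))
  let ?I = "{1..r}"
  have inj: "inj_on B ?I" and blocks: "{H. is_block G H} = B ` ?I"
    using assms(3) by (simp_all only: bij_betw_def)
  have block: "is_block G (B i)" if "i \<in> ?I" for i
    using blocks that by blast
  have xi_B: "q_xi q (B i) (ws i) = q_xi_of q (B i)" if "i \<in> ?I" for i
  proof -
    have "graph (B i)" and conn: "connected (B i)"
      using block[OF that] by (simp_all add: is_block_iff nonseparable_def)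
    then interpret Bi: graph "B i" by simp
    \<comment> \<open>Connectedness includes having a vertex, so \<open>ws i\<close> has a head to
      act as base vertex.\<close>
    have "verts (B i) \<noteq> {}"
      using conn by (simp add: Bi.connected_iff_reachable)
    then show ?thesis
      by (rule q_xi_eq_q_xi_of[OF Bi.wf_digraph _ assms(8)[OF that]])
  qed
  have det_B: "det (q_distance_matrix q (B i) (ws i)) = q_det_of q (B i)" if "i \<in> ?I" for i
    using assms(8)[OF that] by (rule det_q_distance_matrix)
  have formula: "q_det_of q (B i) = (-1) ^ (m i + n i - 2) * (q + 1) ^ (m i + n i - 2)
      * ((q + 1) ^ 2 * (of_nat (m i) - 1) * (of_nat (n i) - 1) - of_nat (m i) * of_nat (n i))"
    "q_xi_of q (B i) = (-1) ^ (m i + n i) * (q + 1) ^ (m i + n i - 1)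
      * (q ^ 2 * (of_nat (m i) - 1) * (of_nat (n i) - 1) - 1)"
    if "i \<in> ?I" for i
  proof -
    have "complete_bipartite_digraph (m i) (n i) (B i)" "1 \<le> m i" "1 \<le> n i"
      using assms(4)[OF that] by simp_all
    from complete_bipartite_q_det_xi[OF this assms(9)]
    show "q_det_of q (B i) = (-1) ^ (m i + n i - 2) * (q + 1) ^ (m i + n i - 2)
        * ((q + 1) ^ 2 * (of_nat (m i) - 1) * (of_nat (n i) - 1) - of_nat (m i) * of_nat (n i))"
      and "q_xi_of q (B i) = (-1) ^ (m i + n i) * (q + 1) ^ (m i + n i - 1)
        * (q ^ 2 * (of_nat (m i) - 1) * (of_nat (n i) - 1) - 1)" .
  qed
  have "verts G \<noteq> {}"
    using G(2) by (simp add: connected_iff_reachable)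
  then have "q_xi q G vs = q_xi_of q G"
    using assms(7) by (rule q_xi_eq_q_xi_of[OF wf_digraph])
  also have "\<dots> = (\<Prod>C\<in>B ` ?I. q_xi_of q C)"
    using q_det_xi_blocks[OF G, of q] unfolding blocks by blast
  also have "\<dots> = (\<Prod>i\<in>?I. q_xi_of q (B i))"
    by (simp only: prod.reindex[OF inj] o_def)
  finally have xi: "q_xi q G vs = (\<Prod>i\<in>?I. q_xi_of q (B i))" .
  have "det (q_distance_matrix q G vs) = q_det_of q G"
    using assms(7) by (rule det_q_distance_matrix)
  also have "\<dots> = (\<Sum>D\<in>B ` ?I. q_det_of q D * (\<Prod>C\<in>B ` ?I - {D}. q_xi_of q C))"
    using q_det_xi_blocks[OF G, of q] unfolding blocks by blast
  also have "\<dots> = (\<Sum>i\<in>?I. q_det_of q (B i) * (\<Prod>C\<in>B ` ?I - {B i}. q_xi_of q C))"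
    by (simp only: sum.reindex[OF inj] o_def)
  also have "\<dots> = (\<Sum>i\<in>?I. det (q_distance_matrix q (B i) (ws i)) * (\<Prod>j\<in>?I - {i}. q_xi q (B j) (ws j)))"
  proof (rule sum.cong)
    fix i assume i: "i \<in> ?I"
    \<comment> \<open>Injectivity of \<open>B\<close> turns omitting a block into omitting its
      index.\<close>
    have "B ` ?I - {B i} = B ` (?I - {i})"
      using i by (subst inj_on_image_set_diff[OF inj]) auto
    then have "(\<Prod>C\<in>B ` ?I - {B i}. q_xi_of q C) = (\<Prod>j\<in>?I - {i}. q_xi_of q (B j))"
      by (simp only: prod.reindex[OF inj_on_subset[OF inj Diff_subset]] o_def)
    also have "\<dots> = (\<Prod>j\<in>?I - {i}. q_xi q (B j) (ws j))"
      by (rule prod.cong) (simp_all add: xi_B)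
    finally show "q_det_of q (B i) * (\<Prod>C\<in>B ` ?I - {B i}. q_xi_of q C)
        = det (q_distance_matrix q (B i) (ws i)) * (\<Prod>j\<in>?I - {i}. q_xi q (B j) (ws j))"
      by (simp add: det_B[OF i])
  qed simp
  finally have det: "det (q_distance_matrix q G vs) = \<dots>" .
  show ?thesis
  proof (intro conjI ballI)
    show "q_xi q G vs = (\<Prod>i\<in>?I. (-1) ^ (m i + n i) * (q + 1) ^ (m i + n i - 1)
        * (q ^ 2 * (of_nat (m i) - 1) * (of_nat (n i) - 1) - 1))"
      unfolding xi by (rule prod.cong[OF refl]) (rule formula(2))
  qed (rule det, simp_all only: det_B xi_B formula)
qed

end
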